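(* Let $\mathbb{E}$ be a congruence hyperextensible category. (1) Any (internal) subtraction $d: X\times X\to X$ on an object $X$ of $\mathbb{E}$ is the difference mapping $d(x,y)=x\circ y^{-1}$ associated with an internal group structure $(X,\circ,0)$ on $X$, and this group structure is necessarily abelian. (2) On any object $X$ there is at most one subtraction. (3) If $X$ and $Y$ are objects each equipped with a subtraction, any morphism $f:X\to Y$ in $\mathbb{E}$ is a homomorphism of subtractions. (4) Given a subtraction $d$ on $X$, it is also an opsubtraction if and only if the associated abelian group $(X,\circ,0)$ is such that $x\circ x=0$.
   Context: All categories are assumed finitely complete. A category is pointed when its terminal object $1$ is also initial; $0$ denotes zero maps, and $0_X:1\to X$ the unique map. For a map $f$, $R[f]$ is its kernel equivalence relation. In a pointed category a punctual span is a pair of split epimorphisms $f:W\to X$, $g:W\to Z$ with given sections $s$ of $f$ and $t$ of $g$ such that $f t=0$ and $g s=0$. A pointed category $\mathbb{E}$ is congruence hyperextensible (also called hyperextensive) when, for any punctual span $(f,s,g,t)$ on $W$ and any equivalence relation $T$ on $W$ with $R[f]\cap R[g]\subset T$, one has $R[f]\cap g^{-1}(t^{-1}(T))\subset T$; i.e. (in generalized elements) if $x\,R[f]\,x'$ and $tg(x)\,T\,tg(x')$ then $x\,T\,x'$. An internal subtraction on $X$ is a morphism $d:X\times X\to X$ with $d(x,0)=x$ and $d(x,x)=0$; it is an opsubtraction if $d(0,x)=x$ and $d(x,x)=0$ (identities understood in generalized elements, with $0$ the zero element of $X$). *)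

theory Defs
  imports Main
begin

section \<open>Categories and finite limits\<close>

record ('o, 'a) cat =
  Obj :: "'o set"
  Arr :: "'a set"
  Dom :: "'a \<Rightarrow> 'o"
  Cod :: "'a \<Rightarrow> 'o"
  Ide :: "'o \<Rightarrow> 'a"
  Cmp :: "'a \<Rightarrow> 'a \<Rightarrow> 'a"  (infixr "\<cdot>\<index>" 70)

text \<open>\<open>g \<cdot>\<^bsub>C\<^esub> f\<close> is "first \<open>f\<close>, then \<open>g\<close>"; it is only meaningful when
  \<open>Cod C f = Dom C g\<close>.\<close>

definition hom :: "('o, 'a) cat \<Rightarrow> 'o \<Rightarrow> 'o \<Rightarrow> 'a set" where
  "hom C X Y = {f \<in> Arr C. Dom C f = X \<and> Cod C f = Y}"

locale category =
  fixes C :: "('o, 'a) cat" (structure)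
  assumes dom_in_Obj: "f \<in> Arr C \<Longrightarrow> Dom C f \<in> Obj C"
    and cod_in_Obj: "f \<in> Arr C \<Longrightarrow> Cod C f \<in> Obj C"
    and ide_in_hom: "X \<in> Obj C \<Longrightarrow> Ide C X \<in> hom C X X"
    and cmp_in_hom: "\<lbrakk>f \<in> hom C X Y; g \<in> hom C Y Z\<rbrakk> \<Longrightarrow> g \<cdot> f \<in> hom C X Z"
    and cmp_ide_right: "f \<in> hom C X Y \<Longrightarrow> f \<cdot> Ide C X = f"
    and cmp_ide_left: "f \<in> hom C X Y \<Longrightarrow> Ide C Y \<cdot> f = f"
    and cmp_assoc: "\<lbrakk>f \<in> hom C X Y; g \<in> hom C Y Z; h \<in> hom C Z V\<rbrakk>
      \<Longrightarrow> (h \<cdot> g) \<cdot> f = h \<cdot> (g \<cdot> f)"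

definition is_functor ::
  "('i, 'j) cat \<Rightarrow> ('o, 'a) cat \<Rightarrow> ('i \<Rightarrow> 'o) \<Rightarrow> ('j \<Rightarrow> 'a) \<Rightarrow> bool" where
  "is_functor J C Fo Fa \<longleftrightarrow>
     (\<forall>i\<in>Obj J. Fo i \<in> Obj C) \<and>
     (\<forall>a\<in>Arr J. Fa a \<in> hom C (Fo (Dom J a)) (Fo (Cod J a))) \<and>
     (\<forall>i\<in>Obj J. Fa (Ide J i) = Ide C (Fo i)) \<and>
     (\<forall>a\<in>Arr J. \<forall>b\<in>Arr J. Cod J a = Dom J b \<longrightarrow> Fa (b \<cdot>\<^bsub>J\<^esub> a) = Fa b \<cdot>\<^bsub>C\<^esub> Fa a)"

definition is_cone ::
  "('i, 'j) cat \<Rightarrow> ('o, 'a) cat \<Rightarrow> ('i \<Rightarrow> 'o) \<Rightarrow> ('j \<Rightarrow> 'a) \<Rightarrow> 'o \<Rightarrow> ('i \<Rightarrow> 'a) \<Rightarrow> bool" where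
  "is_cone J C Fo Fa L l \<longleftrightarrow>
     L \<in> Obj C \<and>
     (\<forall>i\<in>Obj J. l i \<in> hom C L (Fo i)) \<and>
     (\<forall>a\<in>Arr J. Fa a \<cdot>\<^bsub>C\<^esub> l (Dom J a) = l (Cod J a))"

definition is_limit ::
  "('i, 'j) cat \<Rightarrow> ('o, 'a) cat \<Rightarrow> ('i \<Rightarrow> 'o) \<Rightarrow> ('j \<Rightarrow> 'a) \<Rightarrow> 'o \<Rightarrow> ('i \<Rightarrow> 'a) \<Rightarrow> bool" where
  "is_limit J C Fo Fa L l \<longleftrightarrow>
     is_cone J C Fo Fa L l \<and>
     (\<forall>M m. is_cone J C Fo Fa M m \<longrightarrow>
        (\<exists>!u. u \<in> hom C M L \<and> (\<forall>i\<in>Obj J. l i \<cdot>\<^bsub>C\<^esub> u = m i)))"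

text \<open>Every finite category is isomorphic to one whose objects and arrows are natural numbers,
  so it is no restriction to take the shapes \<open>J\<close> over \<open>nat\<close>.\<close>

definition finitely_complete :: "('o, 'a) cat \<Rightarrow> bool" where
  "finitely_complete C \<longleftrightarrow>
     (\<forall>(J :: (nat, nat) cat) Fo Fa.
        category J \<and> finite (Obj J) \<and> finite (Arr J) \<and> is_functor J C Fo Fa \<longrightarrow>
        (\<exists>L l. is_limit J C Fo Fa L l))"


section \<open>Pointed categories\<close>

definition is_terminal :: "('o, 'a) cat \<Rightarrow> 'o \<Rightarrow> bool" where
  "is_terminal C N \<longleftrightarrow> N \<in> Obj C \<and> (\<forall>X\<in>Obj C. \<exists>!u. u \<in> hom C X N)"

definition is_initial :: "('o, 'a) cat \<Rightarrow> 'o \<Rightarrow> bool" where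
  "is_initial C N \<longleftrightarrow> N \<in> Obj C \<and> (\<forall>X\<in>Obj C. \<exists>!u. u \<in> hom C N X)"

definition pointed :: "('o, 'a) cat \<Rightarrow> bool" where
  "pointed C \<longleftrightarrow> (\<exists>N. is_terminal C N \<and> is_initial C N)"

text \<open>In a pointed category the composite \<open>X \<rightarrow> 1 \<rightarrow> Y\<close> does not depend on the choice of the
  zero object.\<close>

definition zero_map :: "('o, 'a) cat \<Rightarrow> 'o \<Rightarrow> 'o \<Rightarrow> 'a" where
  "zero_map C X Y =
     (THE f. \<exists>N u v. is_terminal C N \<and> is_initial C N \<and>
        u \<in> hom C X N \<and> v \<in> hom C N Y \<and> f = v \<cdot>\<^bsub>C\<^esub> u)"


section \<open>Congruence hyperextensible categories\<close>

text \<open>Relations on an object \<open>W\<close> are handled through generalized elements: a relation is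
  evaluated at each stage \<open>A\<close>, where it gives a set of pairs of arrows \<open>A \<rightarrow> W\<close>. By the Yoneda
  lemma, inclusions, intersections and inverse images of relations are computed stagewise.\<close>

definition rel_at :: "('o, 'a) cat \<Rightarrow> 'o \<Rightarrow> 'a \<Rightarrow> 'a \<Rightarrow> 'o \<Rightarrow> ('a \<times> 'a) set" where
  "rel_at C R r0 r1 A = {(r0 \<cdot>\<^bsub>C\<^esub> u, r1 \<cdot>\<^bsub>C\<^esub> u) | u. u \<in> hom C A R}"

definition equivalence_relation ::
  "('o, 'a) cat \<Rightarrow> 'o \<Rightarrow> 'o \<Rightarrow> 'a \<Rightarrow> 'a \<Rightarrow> bool" where
  "equivalence_relation C W R r0 r1 \<longleftrightarrow>
     W \<in> Obj C \<and> R \<in> Obj C \<and> r0 \<in> hom C R W \<and> r1 \<in> hom C R W \<and>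
     (\<forall>A\<in>Obj C. \<forall>u\<in>hom C A R. \<forall>v\<in>hom C A R.
        r0 \<cdot>\<^bsub>C\<^esub> u = r0 \<cdot>\<^bsub>C\<^esub> v \<and> r1 \<cdot>\<^bsub>C\<^esub> u = r1 \<cdot>\<^bsub>C\<^esub> v \<longrightarrow> u = v) \<and>
     (\<forall>A\<in>Obj C. equiv (hom C A W) (rel_at C R r0 r1 A))"

text \<open>The generalized elements of the kernel equivalence relation \<open>R[f]\<close>, as given by the
  universal property of the kernel pair of \<open>f\<close>.\<close>

definition kernel_at :: "('o, 'a) cat \<Rightarrow> 'a \<Rightarrow> 'o \<Rightarrow> ('a \<times> 'a) set" where
  "kernel_at C f A =
     {(x, x'). x \<in> hom C A (Dom C f) \<and> x' \<in> hom C A (Dom C f) \<and> f \<cdot>\<^bsub>C\<^esub> x = f \<cdot>\<^bsub>C\<^esub> x'}"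

definition punctual_span ::
  "('o, 'a) cat \<Rightarrow> 'o \<Rightarrow> 'o \<Rightarrow> 'o \<Rightarrow> 'a \<Rightarrow> 'a \<Rightarrow> 'a \<Rightarrow> 'a \<Rightarrow> bool" where
  "punctual_span C W X Z f s g t \<longleftrightarrow>
     f \<in> hom C W X \<and> s \<in> hom C X W \<and> f \<cdot>\<^bsub>C\<^esub> s = Ide C X \<and>
     g \<in> hom C W Z \<and> t \<in> hom C Z W \<and> g \<cdot>\<^bsub>C\<^esub> t = Ide C Z \<and>
     f \<cdot>\<^bsub>C\<^esub> t = zero_map C Z X \<and> g \<cdot>\<^bsub>C\<^esub> s = zero_map C X Z"

definition congruence_hyperextensible :: "('o, 'a) cat \<Rightarrow> bool" where
  "congruence_hyperextensible C \<longleftrightarrow>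
     category C \<and> finitely_complete C \<and> pointed C \<and>
     (\<forall>W X Z f s g t T r0 r1.
        punctual_span C W X Z f s g t \<and> equivalence_relation C W T r0 r1 \<and>
        (\<forall>A\<in>Obj C. kernel_at C f A \<inter> kernel_at C g A \<subseteq> rel_at C T r0 r1 A) \<longrightarrow>
        (\<forall>A\<in>Obj C.
           kernel_at C f A \<inter>
             inv_image (inv_image (rel_at C T r0 r1 A) (\<lambda>z. t \<cdot>\<^bsub>C\<^esub> z)) (\<lambda>w. g \<cdot>\<^bsub>C\<^esub> w)
           \<subseteq> rel_at C T r0 r1 A))"


section \<open>Internal binary operations, subtractions and groups\<close>

definition is_product :: "('o, 'a) cat \<Rightarrow> 'o \<Rightarrow> 'o \<Rightarrow> 'o \<Rightarrow> 'a \<Rightarrow> 'a \<Rightarrow> bool" where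
  "is_product C X Y P p q \<longleftrightarrow>
     P \<in> Obj C \<and> p \<in> hom C P X \<and> q \<in> hom C P Y \<and>
     (\<forall>A\<in>Obj C. \<forall>x\<in>hom C A X. \<forall>y\<in>hom C A Y.
        \<exists>!u. u \<in> hom C A P \<and> p \<cdot>\<^bsub>C\<^esub> u = x \<and> q \<cdot>\<^bsub>C\<^esub> u = y)"

text \<open>\<open>app2 C p q d x y\<close> is the value \<open>d(x,y) = d \<cdot> \<langle>x,y\<rangle>\<close> at generalized elements \<open>x, y\<close> with a
  common domain of an arrow \<open>d\<close> out of the product with projections \<open>p, q\<close>.\<close>

definition pairing :: "('o, 'a) cat \<Rightarrow> 'a \<Rightarrow> 'a \<Rightarrow> 'a \<Rightarrow> 'a \<Rightarrow> 'a" where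
  "pairing C p q x y =
     (THE u. u \<in> hom C (Dom C x) (Dom C p) \<and> p \<cdot>\<^bsub>C\<^esub> u = x \<and> q \<cdot>\<^bsub>C\<^esub> u = y)"

definition app2 :: "('o, 'a) cat \<Rightarrow> 'a \<Rightarrow> 'a \<Rightarrow> 'a \<Rightarrow> 'a \<Rightarrow> 'a \<Rightarrow> 'a" where
  "app2 C p q d x y = d \<cdot>\<^bsub>C\<^esub> pairing C p q x y"

text \<open>In the following definitions \<open>p, q\<close> are the projections of a product \<open>X \<times> X\<close>.\<close>

definition subtraction :: "('o, 'a) cat \<Rightarrow> 'o \<Rightarrow> 'a \<Rightarrow> 'a \<Rightarrow> 'a \<Rightarrow> bool" where
  "subtraction C X p q d \<longleftrightarrow>
     d \<in> hom C (Dom C p) X \<and>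
     (\<forall>A\<in>Obj C. \<forall>x\<in>hom C A X.
        app2 C p q d x (zero_map C A X) = x \<and>
        app2 C p q d x x = zero_map C A X)"

definition opsubtraction :: "('o, 'a) cat \<Rightarrow> 'o \<Rightarrow> 'a \<Rightarrow> 'a \<Rightarrow> 'a \<Rightarrow> bool" where
  "opsubtraction C X p q d \<longleftrightarrow>
     d \<in> hom C (Dom C p) X \<and>
     (\<forall>A\<in>Obj C. \<forall>x\<in>hom C A X.
        app2 C p q d (zero_map C A X) x = x \<and>
        app2 C p q d x x = zero_map C A X)"

text \<open>Internal group structures with multiplication \<open>m\<close> and inversion \<open>i\<close>. In a pointed category
  the unit \<open>1 \<rightarrow> X\<close> can only be \<open>0\<^sub>X\<close>, whose generalized elements are the zero maps.\<close>

definition internal_group :: "('o, 'a) cat \<Rightarrow> 'o \<Rightarrow> 'a \<Rightarrow> 'a \<Rightarrow> 'a \<Rightarrow> 'a \<Rightarrow> bool" where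
  "internal_group C X p q m i \<longleftrightarrow>
     m \<in> hom C (Dom C p) X \<and> i \<in> hom C X X \<and>
     (\<forall>A\<in>Obj C. \<forall>x\<in>hom C A X. \<forall>y\<in>hom C A X. \<forall>z\<in>hom C A X.
        app2 C p q m (app2 C p q m x y) z = app2 C p q m x (app2 C p q m y z)) \<and>
     (\<forall>A\<in>Obj C. \<forall>x\<in>hom C A X.
        app2 C p q m x (zero_map C A X) = x \<and>
        app2 C p q m (zero_map C A X) x = x \<and>
        app2 C p q m x (i \<cdot>\<^bsub>C\<^esub> x) = zero_map C A X \<and>
        app2 C p q m (i \<cdot>\<^bsub>C\<^esub> x) x = zero_map C A X)"

definition commutative_op :: "('o, 'a) cat \<Rightarrow> 'o \<Rightarrow> 'a \<Rightarrow> 'a \<Rightarrow> 'a \<Rightarrow> bool" where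
  "commutative_op C X p q m \<longleftrightarrow>
     (\<forall>A\<in>Obj C. \<forall>x\<in>hom C A X. \<forall>y\<in>hom C A X. app2 C p q m x y = app2 C p q m y x)"

definition is_difference ::
  "('o, 'a) cat \<Rightarrow> 'o \<Rightarrow> 'a \<Rightarrow> 'a \<Rightarrow> 'a \<Rightarrow> 'a \<Rightarrow> 'a \<Rightarrow> bool" where
  "is_difference C X p q m i d \<longleftrightarrow>
     (\<forall>A\<in>Obj C. \<forall>x\<in>hom C A X. \<forall>y\<in>hom C A X.
        app2 C p q d x y = app2 C p q m x (i \<cdot>\<^bsub>C\<^esub> y))"

definition subtraction_hom ::
  "('o, 'a) cat \<Rightarrow> 'o \<Rightarrow> 'a \<Rightarrow> 'a \<Rightarrow> 'a \<Rightarrow> 'a \<Rightarrow> 'a \<Rightarrow> 'a \<Rightarrow> 'a \<Rightarrow> bool" where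
  "subtraction_hom C X p q d p' q' d' f \<longleftrightarrow>
     (\<forall>A\<in>Obj C. \<forall>x\<in>hom C A X. \<forall>y\<in>hom C A X.
        f \<cdot>\<^bsub>C\<^esub> app2 C p q d x y = app2 C p' q' d' (f \<cdot>\<^bsub>C\<^esub> x) (f \<cdot>\<^bsub>C\<^esub> y))"

end

theory Submission
  imports Defs
begin

text \<open>For a product \<open>X \<times> Z\<close> with its canonical punctual span, and for \<open>T\<close> the kernel equivalence
  relation of an arrow \<open>h\<close>, hyperextensibility becomes a term condition: \<open>h(0,z) = h(0,z')\<close> implies
  \<open>h(x,z) = h(x,z')\<close>. Applied to \<open>h((x,y),u) = d(d(x,u),d(y,u))\<close>, which vanishes at \<open>((0,0),u)\<close>, it
  gives \<open>d(d(x,u),d(y,u)) = d(x,y)\<close>, and this identity makes \<open>x + y = d(x,d(0,y))\<close> a group law with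
  difference \<open>d\<close>. Applied to \<open>h(x,u) = (f(x + u) - f(x)) - f(u)\<close>, which vanishes at \<open>(0,u)\<close> and at
  \<open>(x,0)\<close>, it gives \<open>f(x + u) = f(u) + f(x)\<close> for every arrow \<open>f\<close>: the case \<open>f = id\<close> is commutativity,
  and then every arrow is a homomorphism, whence also uniqueness.\<close>

section \<open>Pullbacks and products\<close>

text \<open>Arrows \<open>0, 1, 2\<close> are the identities, and \<open>3 : 0 \<rightarrow> 2\<close>, \<open>4 : 1 \<rightarrow> 2\<close>.\<close>

definition cospan_shape :: "(nat, nat) cat" where
  "cospan_shape = \<lparr>Obj = {..<3}, Arr = {..<5},
     Dom = (\<lambda>a. if a < 3 then a else a - 3), Cod = (\<lambda>a. if a < 3 then a else 2),
     Ide = (\<lambda>i. i), Cmp = (\<lambda>b a. if a < 3 then b else a)\<rparr>"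

lemma category_cospan_shape: "category cospan_shape"
  by unfold_locales (auto simp: cospan_shape_def hom_def split: if_splits)

context category
begin

lemma hom_Obj: "f \<in> hom C X Y \<Longrightarrow> X \<in> Obj C" "f \<in> hom C X Y \<Longrightarrow> Y \<in> Obj C"
  using dom_in_Obj cod_in_Obj by (auto simp: hom_def)

lemma hom_Dom: "f \<in> hom C X Y \<Longrightarrow> Dom C f = X"
  by (simp add: hom_def)

text \<open>In a cone over the cospan, the leg into \<open>V\<close> is \<open>f\<close> after the
  leg into \<open>X\<close>. The two remaining legs therefore carry all the data, and the universal
  property of the limit can be restated with \<open>r0\<close> and \<open>r1\<close> alone.\<close>

lemma pullback_exists:
  assumes fc: "finitely_complete C" and f: "f \<in> hom C X V" and g: "g \<in> hom C Y V"
  obtains R r0 r1 where "r0 \<in> hom C R X" "r1 \<in> hom C R Y" "f \<cdot> r0 = g \<cdot> r1"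
    "\<forall>A. \<forall>x\<in>hom C A X. \<forall>y\<in>hom C A Y. f \<cdot> x = g \<cdot> y
       \<longrightarrow> (\<exists>!u. u \<in> hom C A R \<and> r0 \<cdot> u = x \<and> r1 \<cdot> u = y)"
proof -
  define Fo where "Fo = (\<lambda>i::nat. if i = 0 then X else if i = 1 then Y else V)"
  define Fa where "Fa = (\<lambda>a::nat. if a < 3 then Ide C (Fo a) else if a = 3 then f else g)"
  let ?J = cospan_shape
  have obj: "Obj ?J = {0, 1, 2}" and arr: "Arr ?J = {0, 1, 2, 3, 4}"
    by (auto simp: cospan_shape_def)
  have [simp]: "Dom ?J a = (if a < 3 then a else a - 3)" "Cod ?J a = (if a < 3 then a else 2)"
    "Ide ?J i = i" "b \<cdot>\<^bsub>?J\<^esub> a = (if a < 3 then b else a)" for a b i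
    by (simp_all add: cospan_shape_def)
  have O: "X \<in> Obj C" "Y \<in> Obj C" "V \<in> Obj C"
    using f g hom_Obj by auto
  have diagram: "is_functor ?J C Fo Fa"
    unfolding is_functor_def
    using O f g ide_in_hom cmp_ide_left[OF f] cmp_ide_left[OF g] cmp_ide_right[OF f]
      cmp_ide_right[OF g] cmp_ide_left[OF ide_in_hom]
    by (auto simp: obj arr Fo_def Fa_def)
  have "finite (Obj ?J)" "finite (Arr ?J)"
    by (auto simp: cospan_shape_def)
  then obtain R l where lim: "is_limit ?J C Fo Fa R l"
    using fc category_cospan_shape diagram unfolding finitely_complete_def by blast
  have l: "l 0 \<in> hom C R X" "l 1 \<in> hom C R Y" "f \<cdot> l 0 = l 2" "g \<cdot> l 1 = l 2"
    using lim unfolding is_limit_def is_cone_def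
    by (auto simp: obj arr Fo_def Fa_def)
  show thesis
  proof (rule that[of "l 0" R "l 1"]; (intro allI ballI impI)?)
    show "l 0 \<in> hom C R X" "l 1 \<in> hom C R Y" "f \<cdot> l 0 = g \<cdot> l 1"
      using l by auto
    fix A x y
    assume x: "x \<in> hom C A X" and y: "y \<in> hom C A Y" and e: "f \<cdot> x = g \<cdot> y"
    define m where "m = (\<lambda>i::nat. if i = 0 then x else if i = 1 then y else f \<cdot> x)"
    have fx: "f \<cdot> x \<in> hom C A V"
      using x f by (rule cmp_in_hom)
    have "is_cone ?J C Fo Fa A m"
      unfolding is_cone_def
      using x y fx e hom_Obj(1)[OF x] cmp_ide_left
      by (auto simp: obj arr Fo_def Fa_def m_def)
    then have ex1: "\<exists>!u. u \<in> hom C A R \<and> (\<forall>i\<in>Obj ?J. l i \<cdot> u = m i)"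
      using lim unfolding is_limit_def by blast
    have "(\<forall>i\<in>Obj ?J. l i \<cdot> u = m i) \<longleftrightarrow> l 0 \<cdot> u = x \<and> l 1 \<cdot> u = y"
      if u: "u \<in> hom C A R" for u
      using cmp_assoc[OF u l(1) f] by (auto simp: obj m_def l(3))
    then show "\<exists>!u. u \<in> hom C A R \<and> l 0 \<cdot> u = x \<and> l 1 \<cdot> u = y"
      using ex1 by metis
  qed
qed

text \<open>A product is a pullback over the terminal object: every square into \<open>N\<close>
  commutes, so the side condition of the pullback is vacuous.\<close>

lemma product_exists:
  assumes fc: "finitely_complete C" and N: "is_terminal C N"
    and X: "X \<in> Obj C" and Y: "Y \<in> Obj C"
  obtains P p q where "is_product C X Y P p q"
proof -
  have N': "\<exists>!u. u \<in> hom C A N" if "A \<in> Obj C" for A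
    using N that by (simp add: is_terminal_def)
  obtain f g where f: "f \<in> hom C X N" and g: "g \<in> hom C Y N"
    using N'[OF X] N'[OF Y] by blast
  obtain P p q where P: "p \<in> hom C P X" "q \<in> hom C P Y"
    and univ: "\<forall>A. \<forall>x\<in>hom C A X. \<forall>y\<in>hom C A Y. f \<cdot> x = g \<cdot> y
       \<longrightarrow> (\<exists>!u. u \<in> hom C A P \<and> p \<cdot> u = x \<and> q \<cdot> u = y)"
    by (rule pullback_exists[OF fc f g]) (rule that)
  have "f \<cdot> x = g \<cdot> y" if "x \<in> hom C A X" "y \<in> hom C A Y" for A x y
    using N'[OF hom_Obj(1)[OF that(1)]] cmp_in_hom[OF that(1) f] cmp_in_hom[OF that(2) g]
    by blast
  then have "is_product C X Y P p q"
    unfolding is_product_def using P univ hom_Obj(1)[OF P(1)] by simp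
  then show thesis
    by (rule that)
qed

end

section \<open>Binary products through generalized elements\<close>

locale binary_product = category +
  fixes X Y P p q
  assumes product: "is_product C X Y P p q"
begin

lemma proj_in_hom: "p \<in> hom C P X" "q \<in> hom C P Y"
  using product by (auto simp: is_product_def)

lemma pairing_ex1:
  assumes "x \<in> hom C A X" "y \<in> hom C A Y"
  shows "\<exists>!u. u \<in> hom C A P \<and> p \<cdot> u = x \<and> q \<cdot> u = y"
  using product assms hom_Obj(1)[OF assms(1)] unfolding is_product_def by blast

lemma
  assumes "x \<in> hom C A X" "y \<in> hom C A Y"
  shows pairing_in_hom: "pairing C p q x y \<in> hom C A P"
    and proj_pairing: "p \<cdot> pairing C p q x y = x" "q \<cdot> pairing C p q x y = y"
proof -
  have "Dom C x = A" "Dom C p = P"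
    using assms proj_in_hom by (auto simp: hom_def)
  then have "pairing C p q x y = (THE u. u \<in> hom C A P \<and> p \<cdot> u = x \<and> q \<cdot> u = y)"
    by (simp add: pairing_def)
  then show "pairing C p q x y \<in> hom C A P"
    "p \<cdot> pairing C p q x y = x" "q \<cdot> pairing C p q x y = y"
    using theI'[OF pairing_ex1[OF assms]] by auto
qed

lemma pairing_eqI:
  assumes "u \<in> hom C A P" "p \<cdot> u = x" "q \<cdot> u = y"
  shows "pairing C p q x y = u"
proof -
  have xy: "x \<in> hom C A X" "y \<in> hom C A Y"
    using cmp_in_hom[OF assms(1) proj_in_hom(1)] cmp_in_hom[OF assms(1) proj_in_hom(2)] assms(2,3)
    by auto
  show ?thesis
    using pairing_ex1[OF xy] assms pairing_in_hom[OF xy] proj_pairing[OF xy] by blast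
qed

lemma product_ext:
  assumes "u \<in> hom C A P" "v \<in> hom C A P" "p \<cdot> u = p \<cdot> v" "q \<cdot> u = q \<cdot> v"
  shows "u = v"
  using pairing_eqI[OF assms(1,3,4)] pairing_eqI[OF assms(2) refl refl] by simp

lemma pairing_comp:
  assumes xy: "x \<in> hom C A X" "y \<in> hom C A Y" and a: "a \<in> hom C B A"
  shows "pairing C p q x y \<cdot> a = pairing C p q (x \<cdot> a) (y \<cdot> a)"
proof (rule pairing_eqI[symmetric])
  note u = pairing_in_hom[OF xy]
  show "pairing C p q x y \<cdot> a \<in> hom C B P"
    using a u by (rule cmp_in_hom)
  show "p \<cdot> (pairing C p q x y \<cdot> a) = x \<cdot> a" "q \<cdot> (pairing C p q x y \<cdot> a) = y \<cdot> a"
    using cmp_assoc[OF a u proj_in_hom(1)] cmp_assoc[OF a u proj_in_hom(2)] proj_pairing[OF xy]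
    by simp_all
qed

lemma pairing_proj: "pairing C p q p q = Ide C P"
  using ide_in_hom[OF hom_Obj(1)[OF proj_in_hom(1)]]
    cmp_ide_right[OF proj_in_hom(1)] cmp_ide_right[OF proj_in_hom(2)]
  by (rule pairing_eqI)

lemma app2_in_hom:
  assumes "h \<in> hom C P V" "x \<in> hom C A X" "y \<in> hom C A Y"
  shows "app2 C p q h x y \<in> hom C A V"
  unfolding app2_def using cmp_in_hom[OF pairing_in_hom[OF assms(2,3)] assms(1)] .

lemma app2_comp:
  assumes "h \<in> hom C P V" "x \<in> hom C A X" "y \<in> hom C A Y" "a \<in> hom C B A"
  shows "app2 C p q h x y \<cdot> a = app2 C p q h (x \<cdot> a) (y \<cdot> a)"
  unfolding app2_def
  using cmp_assoc[OF assms(4) pairing_in_hom[OF assms(2,3)] assms(1)] pairing_comp[OF assms(2-4)]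
  by simp

lemma app2_proj: "h \<in> hom C P V \<Longrightarrow> app2 C p q h p q = h"
  unfolding app2_def pairing_proj by (rule cmp_ide_right)

text \<open>The Yoneda lemma: a natural operation on generalized elements is given by its value at the
  projections.\<close>

lemma app2_natural:
  assumes nat: "\<And>A B a x y. \<lbrakk>a \<in> hom C B A; x \<in> hom C A X; y \<in> hom C A Y\<rbrakk>
      \<Longrightarrow> H x y \<cdot> a = H (x \<cdot> a) (y \<cdot> a)"
    and xy: "x \<in> hom C A X" "y \<in> hom C A Y"
  shows "app2 C p q (H p q) x y = H x y"
  unfolding app2_def
  using nat[OF pairing_in_hom[OF xy] proj_in_hom] proj_pairing[OF xy] by simp

end

section \<open>Zero maps\<close>

locale pointed_category = category +
  assumes pointed: "pointed C"
begin

text \<open>Makes the definite description usable: the composite through one zero object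
  \<open>N\<close> is the composite through any other.\<close>

lemma zero_map_eq:
  assumes N: "is_terminal C N" "is_initial C N"
    and u: "u \<in> hom C X N" and v: "v \<in> hom C N Y"
  shows "zero_map C X Y = v \<cdot> u"
  unfolding zero_map_def
proof (rule the_equality)
  show "\<exists>N u' v'. is_terminal C N \<and> is_initial C N \<and> u' \<in> hom C X N \<and> v' \<in> hom C N Y
      \<and> v \<cdot> u = v' \<cdot> u'"
    using assms by blast
  fix f
  assume "\<exists>N u v. is_terminal C N \<and> is_initial C N \<and> u \<in> hom C X N \<and> v \<in> hom C N Y \<and> f = v \<cdot> u"
  then obtain N' u' v' where N': "is_terminal C N'" and u': "u' \<in> hom C X N'"
    and v': "v' \<in> hom C N' Y" and f: "f = v' \<cdot> u'"
    by blast
  \<comment> \<open>The comparison arrow between the two zero objects. Terminality of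
    \<open>N'\<close> absorbs it into \<open>u'\<close>, initiality of \<open>N\<close> absorbs it
    into \<open>v\<close>, so both composites equal \<open>v' \<cdot> w \<cdot> u\<close>.\<close>
  obtain w where w: "w \<in> hom C N N'"
    using N N' unfolding is_terminal_def by blast
  have "w \<cdot> u = u'"
    using N' u' cmp_in_hom[OF u w] hom_Obj(1)[OF u] unfolding is_terminal_def by blast
  moreover have "v' \<cdot> w = v"
    using N(2) v cmp_in_hom[OF w v'] hom_Obj(2)[OF v] unfolding is_initial_def by blast
  ultimately show "f = v \<cdot> u"
    using f cmp_assoc[OF u w v'] by simp
qed

lemma zero_map_factors:
  assumes "X \<in> Obj C" "Y \<in> Obj C"
  obtains N u v where "is_terminal C N" "is_initial C N" "u \<in> hom C X N" "v \<in> hom C N Y"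
    "zero_map C X Y = v \<cdot> u"
proof -
  obtain N where N: "is_terminal C N" "is_initial C N"
    using pointed by (auto simp: pointed_def)
  then obtain u v where "u \<in> hom C X N" "v \<in> hom C N Y"
    using assms unfolding is_terminal_def is_initial_def by blast
  then show thesis
    using N that zero_map_eq by blast
qed

lemma zero_map_in_hom: "\<lbrakk>X \<in> Obj C; Y \<in> Obj C\<rbrakk> \<Longrightarrow> zero_map C X Y \<in> hom C X Y"
  using zero_map_factors cmp_in_hom by metis

lemma comp_zero_map:
  assumes X: "X \<in> Obj C" and f: "f \<in> hom C Y Z"
  shows "f \<cdot> zero_map C X Y = zero_map C X Z"
proof -
  obtain N u v where N: "is_terminal C N" "is_initial C N"
    and u: "u \<in> hom C X N" and v: "v \<in> hom C N Y" and z: "zero_map C X Y = v \<cdot> u"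
    by (rule zero_map_factors[OF X hom_Obj(1)[OF f]])
  show ?thesis
    using zero_map_eq[OF N u cmp_in_hom[OF v f]] cmp_assoc[OF u v f] z by simp
qed

lemma zero_map_comp:
  assumes Z: "Z \<in> Obj C" and f: "f \<in> hom C X Y"
  shows "zero_map C Y Z \<cdot> f = zero_map C X Z"
proof -
  obtain N u v where N: "is_terminal C N" "is_initial C N"
    and u: "u \<in> hom C Y N" and v: "v \<in> hom C N Z" and z: "zero_map C Y Z = v \<cdot> u"
    by (rule zero_map_factors[OF hom_Obj(2)[OF f] Z])
  show ?thesis
    using zero_map_eq[OF N cmp_in_hom[OF f u] v] cmp_assoc[OF f u v] z by simp
qed

end

section \<open>The term condition\<close>

locale hyperextensible_category =
  fixes C :: "('o, 'a) cat" (structure)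
  assumes hyperextensible: "congruence_hyperextensible C"
begin

sublocale pointed_category
  using hyperextensible
  by (simp add: congruence_hyperextensible_def pointed_category_def pointed_category_axioms_def)

lemma finitely_complete: "finitely_complete C"
  using hyperextensible by (simp add: congruence_hyperextensible_def)

text \<open>The pullback of \<open>h\<close> along itself represents \<open>R[h]\<close>. Uniqueness
  in its universal property gives joint monicity, and at each stage the relation is equality of
  images under \<open>h\<close>, hence an equivalence.\<close>

lemma kernel_equivalence_relation:
  assumes h: "h \<in> hom C W V"
  obtains T r0 r1 where "equivalence_relation C W T r0 r1"
    "\<forall>A. rel_at C T r0 r1 A = kernel_at C h A"
proof -
  obtain T r0 r1 where r: "r0 \<in> hom C T W" "r1 \<in> hom C T W" "h \<cdot> r0 = h \<cdot> r1"
    and univ: "\<forall>A. \<forall>x\<in>hom C A W. \<forall>y\<in>hom C A W. h \<cdot> x = h \<cdot> y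
       \<longrightarrow> (\<exists>!u. u \<in> hom C A T \<and> r0 \<cdot> u = x \<and> r1 \<cdot> u = y)"
    by (rule pullback_exists[OF finitely_complete h h]) (rule that)
  have comp: "h \<cdot> (r0 \<cdot> u) = h \<cdot> (r1 \<cdot> u)" if "u \<in> hom C A T" for u A
    using cmp_assoc[OF that r(1) h] cmp_assoc[OF that r(2) h] r(3) by simp
  have rel: "rel_at C T r0 r1 A = kernel_at C h A" for A
  proof (intro equalityI subrelI)
    fix x y assume "(x, y) \<in> rel_at C T r0 r1 A"
    then obtain u where u: "u \<in> hom C A T" and xy: "x = r0 \<cdot> u" "y = r1 \<cdot> u"
      by (auto simp: rel_at_def)
    show "(x, y) \<in> kernel_at C h A"
      using cmp_in_hom[OF u r(1)] cmp_in_hom[OF u r(2)] comp[OF u]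
      by (simp add: kernel_at_def hom_Dom[OF h] xy)
  next
    fix x y assume "(x, y) \<in> kernel_at C h A"
    then have "x \<in> hom C A W" "y \<in> hom C A W" "h \<cdot> x = h \<cdot> y"
      by (simp_all add: kernel_at_def hom_Dom[OF h])
    from ex1_implies_ex[OF univ[rule_format, OF this]]
    show "(x, y) \<in> rel_at C T r0 r1 A"
      by (auto simp: rel_at_def)
  qed
  have eq: "equiv (hom C A W) (kernel_at C h A)" for A
    by (auto simp: equiv_def refl_on_def sym_def trans_def kernel_at_def hom_Dom[OF h])
  have mono: "u = v" if u: "u \<in> hom C A T" and v: "v \<in> hom C A T"
    and e: "r0 \<cdot> u = r0 \<cdot> v" "r1 \<cdot> u = r1 \<cdot> v" for A u v
    by (rule ex1E[OF univ[rule_format, OF cmp_in_hom[OF u r(1)] cmp_in_hom[OF u r(2)] comp[OF u]]])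
      (use u v e in auto)
  have "equivalence_relation C W T r0 r1"
    unfolding equivalence_relation_def
    using r(1,2) eq mono hom_Obj[OF r(1)] by (simp add: rel)
  then show thesis
    using rel by (intro that) auto
qed

text \<open>Hyperextensibility is applied to the two projections, split by the axis inclusions, with
  \<open>T = R[h]\<close>. The elements (x,z) and (x,z') agree under \<open>p\<close>, and passing
  through \<open>q\<close> and \<open>t\<close> turns them into (0,z) and (0,z'), which
  \<open>h\<close> identifies by assumption.\<close>

lemma product_term_condition:
  assumes prod: "is_product C X Z W p q" and h: "h \<in> hom C W V"
    and x: "x \<in> hom C A X" and z: "z \<in> hom C A Z" "z' \<in> hom C A Z"
    and eq: "app2 C p q h (zero_map C A X) z = app2 C p q h (zero_map C A X) z'"
  shows "app2 C p q h x z = app2 C p q h x z'"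
proof -
  interpret binary_product C X Z W p q
    using prod by unfold_locales
  note O = hom_Obj(2)[OF x] hom_Obj(2)[OF z(1)] hom_Obj(1)[OF x]
  define s where "s = pairing C p q (Ide C X) (zero_map C X Z)"
  define t where "t = pairing C p q (zero_map C Z X) (Ide C Z)"
  have span: "punctual_span C W X Z p s q t"
    unfolding punctual_span_def s_def t_def
    using O ide_in_hom zero_map_in_hom proj_in_hom pairing_in_hom
      proj_pairing[OF ide_in_hom zero_map_in_hom] proj_pairing[OF zero_map_in_hom ide_in_hom]
    by simp
  obtain T r0 r1 where T: "equivalence_relation C W T r0 r1"
    and rel: "\<forall>A. rel_at C T r0 r1 A = kernel_at C h A"
    by (rule kernel_equivalence_relation[OF h]) (rule that)
  \<comment> \<open>The projections are jointly monic, so this intersection is the diagonal, which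
    lies in every kernel relation.\<close>
  have "kernel_at C p B \<inter> kernel_at C q B \<subseteq> rel_at C T r0 r1 B" for B
    unfolding rel[rule_format] kernel_at_def hom_Dom[OF h] hom_Dom[OF proj_in_hom(1)] hom_Dom[OF proj_in_hom(2)]
    using product_ext by fast
  then have main: "kernel_at C p A \<inter>
      inv_image (inv_image (kernel_at C h A) (\<lambda>z. t \<cdot> z)) (\<lambda>w. q \<cdot> w) \<subseteq> kernel_at C h A"
    using hyperextensible span T O(3) rel unfolding congruence_hyperextensible_def by metis
  have t: "t \<cdot> y = pairing C p q (zero_map C A X) y" if "y \<in> hom C A Z" for y
    unfolding t_def using that O
    by (simp add: pairing_comp[where A = Z and B = A] zero_map_in_hom ide_in_hom
        zero_map_comp cmp_ide_left)
  have "(pairing C p q x z, pairing C p q x z') \<in> kernel_at C h A"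
    using eq x z O
    by (intro subsetD[OF main])
      (auto simp: kernel_at_def hom_Dom[OF h] hom_Dom[OF proj_in_hom(1)] pairing_in_hom
        proj_pairing t app2_def zero_map_in_hom)
  then show ?thesis
    by (simp add: kernel_at_def app2_def)
qed

text \<open>By the Yoneda lemma a natural operation \<open>H\<close> is the arrow
  \<open>H p q\<close> out of a product. This form hides the choice of that product and allows
  \<open>H\<close> to be written as a term in generalized elements.\<close>

lemma term_condition:
  assumes in_hom: "\<And>A x z. \<lbrakk>x \<in> hom C A X; z \<in> hom C A Z\<rbrakk> \<Longrightarrow> H x z \<in> hom C A V"
    and nat: "\<And>A B a x z. \<lbrakk>a \<in> hom C B A; x \<in> hom C A X; z \<in> hom C A Z\<rbrakk>
      \<Longrightarrow> H x z \<cdot> a = H (x \<cdot> a) (z \<cdot> a)"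
    and x: "x \<in> hom C A X" and z: "z \<in> hom C A Z" "z' \<in> hom C A Z"
    and eq: "H (zero_map C A X) z = H (zero_map C A X) z'"
  shows "H x z = H x z'"
proof -
  obtain N where "is_terminal C N"
    using pointed by (auto simp: pointed_def)
  then obtain W p q where prod: "is_product C X Z W p q"
    by (rule product_exists[OF finitely_complete _ hom_Obj(2)[OF x] hom_Obj(2)[OF z(1)]])
  then interpret binary_product C X Z W p q
    by unfold_locales
  have app2: "app2 C p q (H p q) x z = H x z" if "x \<in> hom C A X" "z \<in> hom C A Z" for x z
    using nat that by (rule app2_natural)
  have "zero_map C A X \<in> hom C A X"
    using hom_Obj[OF x] by (rule zero_map_in_hom)
  then show ?thesis
    using product_term_condition[OF prod in_hom[OF proj_in_hom] x z] eq app2 x z by simp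
qed

end

section \<open>Subtractions\<close>

locale subtraction_object = hyperextensible_category +
  fixes X P p q d
  assumes prod: "is_product C X X P p q" and subtraction: "subtraction C X p q d"
begin

sublocale binary_product C X X P p q
  using prod by unfold_locales

abbreviation diff where "diff \<equiv> app2 C p q d"
abbreviation zero where "zero A \<equiv> zero_map C A X"
text \<open>The stage \<open>A\<close> is an explicit argument because the zero element belongs to a
  stage.\<close>

abbreviation add where "add A x y \<equiv> diff x (diff (zero A) y)"

lemma d_in_hom: "d \<in> hom C P X"
  using subtraction hom_Dom[OF proj_in_hom(1)] by (simp add: subtraction_def)

lemma X_Obj: "X \<in> Obj C"
  using d_in_hom by (rule hom_Obj)

lemmas diff_in_hom = app2_in_hom[OF d_in_hom]
  and diff_comp = app2_comp[OF d_in_hom]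

lemma zero_in_hom: "A \<in> Obj C \<Longrightarrow> zero A \<in> hom C A X"
  by (rule zero_map_in_hom[OF _ X_Obj])

lemma zero_comp: "a \<in> hom C B A \<Longrightarrow> zero A \<cdot> a = zero B"
  using X_Obj by (rule zero_map_comp)

lemma diff_zero: "x \<in> hom C A X \<Longrightarrow> diff x (zero A) = x"
  and diff_self: "x \<in> hom C A X \<Longrightarrow> diff x x = zero A"
  using subtraction hom_Obj(1) by (auto simp: subtraction_def)

lemma add_in_hom: "\<lbrakk>x \<in> hom C A X; y \<in> hom C A X\<rbrakk> \<Longrightarrow> add A x y \<in> hom C A X"
  using hom_Obj(1) by (intro diff_in_hom zero_in_hom) auto

lemma add_comp:
  assumes "x \<in> hom C A X" "y \<in> hom C A X" "a \<in> hom C B A"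
  shows "add A x y \<cdot> a = add B (x \<cdot> a) (y \<cdot> a)"
  using assms hom_Obj(1)[OF assms(1)]
  by (simp add: diff_comp[of _ A _ _ B] diff_in_hom zero_in_hom zero_comp)

text \<open>Translation invariance of the subtraction: all later group identities are instances of
  it. By the term condition the value does not depend on \<open>u\<close>, so \<open>u\<close> may
  be replaced by zero.\<close>

lemma diff_diff:
  assumes x: "x \<in> hom C A X" and y: "y \<in> hom C A X" and u: "u \<in> hom C A X"
  shows "diff (diff x u) (diff y u) = diff x y"
proof -
  \<comment> \<open>The pair (x,y) is packed into one element \<open>w\<close> of the product
    \<open>P\<close>, since the term condition has a single variable on each side.\<close>
  define H where "H = (\<lambda>w u. diff (diff (p \<cdot> w) u) (diff (q \<cdot> w) u))"
  note A = hom_Obj(1)[OF x]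
  note zA = zero_in_hom[OF A]
  have "H (pairing C p q x y) u = H (pairing C p q x y) (zero A)"
  proof (rule term_condition[of P X H X])
    fix A w u assume wu: "w \<in> hom C A P" "u \<in> hom C A X"
    then have pw: "p \<cdot> w \<in> hom C A X" and qw: "q \<cdot> w \<in> hom C A X"
      using proj_in_hom cmp_in_hom by auto
    then show "H w u \<in> hom C A X"
      using wu by (simp add: H_def diff_in_hom)
    fix B a assume a: "a \<in> hom C B A"
    show "H w u \<cdot> a = H (w \<cdot> a) (u \<cdot> a)"
      using pw qw wu a cmp_assoc[OF a wu(1)] proj_in_hom
      by (simp add: H_def diff_in_hom diff_comp[of _ A _ _ B])
  next
    \<comment> \<open>At the zero pair both inner differences are 0 - v, so the outer one vanishes
      whatever \<open>v\<close> is.\<close>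
    have "H (zero_map C A P) v = zero A" if v: "v \<in> hom C A X" for v
      using v A proj_in_hom diff_self[OF diff_in_hom[OF zA v]] by (simp add: H_def comp_zero_map)
    then show "H (zero_map C A P) u = H (zero_map C A P) (zero A)"
      using u zA by simp
  qed (use assms zA pairing_in_hom in auto)
  then show ?thesis
    using assms by (simp add: H_def proj_pairing diff_zero)
qed

section \<open>Group arithmetic at a fixed stage\<close>

context
  fixes A assumes A: "A \<in> Obj C"
begin

lemmas zA = zero_in_hom[OF A]

text \<open>Translation invariance with second argument zero: (x - u) - (0 - u) = x - 0.\<close>

lemma diff_add_cancel:
  assumes "x \<in> hom C A X" "u \<in> hom C A X"
  shows "add A (diff x u) u = x"
  using diff_diff[OF assms(1) zA assms(2)] diff_zero[OF assms(1)] by simp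

lemma neg_neg: "u \<in> hom C A X \<Longrightarrow> diff (zero A) (diff (zero A) u) = u"
  using diff_add_cancel[of u u] diff_self by simp

lemma neg_diff:
  assumes "y \<in> hom C A X" "u \<in> hom C A X"
  shows "diff (zero A) (diff y u) = diff u y"
  using diff_diff[OF assms(2,1,2)] diff_self[OF assms(2)] by simp

text \<open>This is \<open>diff_add_cancel\<close> for 0 - u in place of u, because double negation
  returns \<open>u\<close>.\<close>

lemma add_diff_cancel:
  assumes "x \<in> hom C A X" "u \<in> hom C A X"
  shows "diff (add A x u) u = x"
  using diff_add_cancel[OF assms(1) diff_in_hom[OF zA assms(2)]] neg_neg[OF assms(2)] by simp

text \<open>Adding \<open>u\<close> back to the difference gives x = (x - u) + u = 0 + u =
  u.\<close>

lemma eq_if_diff_zero: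
  assumes "x \<in> hom C A X" "u \<in> hom C A X" "diff x u = zero A"
  shows "x = u"
  using diff_add_cancel[OF assms(1,2)] neg_neg[OF assms(2)] assms(3) by simp

lemma add_assoc:
  assumes x: "x \<in> hom C A X" and y: "y \<in> hom C A X" and z: "z \<in> hom C A X"
  shows "add A (add A x y) z = add A x (add A y z)"
proof -
  let ?n = "diff (zero A)"
  have ny: "?n y \<in> hom C A X" and nz: "?n z \<in> hom C A X"
    using diff_in_hom zA y z by auto
  \<comment> \<open>Here -z is rewritten as (-z - y) - (-y), so that both arguments of the outer
    difference are translated by -y and translation invariance removes it.\<close>
  have "diff (add A x y) (?n z) = diff (diff x (?n y)) (diff (diff (?n z) y) (?n y))"
    using diff_add_cancel[OF nz y] by simp
  also have "\<dots> = diff x (diff (?n z) y)"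
    using diff_diff[OF x diff_in_hom[OF nz y] ny] .
  also have "\<dots> = add A x (add A y z)"
    using neg_diff[OF y nz] by simp
  finally show ?thesis .
qed

end

section \<open>The group associated with a subtraction\<close>

lemma group_exists:
  "\<exists>m i. internal_group C X p q m i \<and> is_difference C X p q m i d"
proof -
  note P = hom_Obj(1)[OF proj_in_hom(1)]
  \<comment> \<open>The arrows \<open>m\<close> and \<open>i\<close> are the sum and the negation
    evaluated at the universal elements, namely the two projections and the identity. Naturality
    recovers their values at all other elements.\<close>
  define m where "m = add P p q"
  define i where "i = diff (zero X) (Ide C X)"
  have m_hom: "m \<in> hom C P X"
    unfolding m_def using proj_in_hom by (rule add_in_hom)
  have i_hom: "i \<in> hom C X X"
    unfolding i_def using zero_in_hom ide_in_hom X_Obj diff_in_hom by blast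
  have m: "app2 C p q m x y = add A x y" if x: "x \<in> hom C A X" and y: "y \<in> hom C A X" for A x y
    unfolding m_def app2_def[of C p q "add P p q"]
    using add_comp[OF proj_in_hom pairing_in_hom[OF x y]] proj_pairing[OF x y] by simp
  have i: "i \<cdot> x = diff (zero A) x" if x: "x \<in> hom C A X" for A x
    unfolding i_def
    using diff_comp[OF zero_in_hom[OF X_Obj] ide_in_hom[OF X_Obj] x] zero_comp[OF x]
      cmp_ide_left[OF x] by simp
  have ix: "diff (zero A) x \<in> hom C A X" if x: "x \<in> hom C A X" for A x
    using zero_in_hom[OF hom_Obj(1)[OF x]] x by (rule diff_in_hom)
  have "internal_group C X p q m i"
    unfolding internal_group_def
  proof (intro conjI ballI)
    show "m \<in> hom C (Dom C p) X" "i \<in> hom C X X"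
      using m_hom i_hom hom_Dom[OF proj_in_hom(1)] by auto
  next
    fix A x y z assume A: "A \<in> Obj C" and xyz: "x \<in> hom C A X" "y \<in> hom C A X" "z \<in> hom C A X"
    show "app2 C p q m (app2 C p q m x y) z = app2 C p q m x (app2 C p q m y z)"
      using add_assoc[OF A xyz] xyz m[OF add_in_hom[OF xyz(1,2)] xyz(3)]
        m[OF xyz(1) add_in_hom[OF xyz(2,3)]] by (simp add: m)
  next
    fix A x assume A: "A \<in> Obj C" and x: "x \<in> hom C A X"
    note z = zero_in_hom[OF A]
    show "app2 C p q m x (zero A) = x"
      using m[OF x z] diff_self[OF z] diff_zero[OF x] by simp
    show "app2 C p q m (zero A) x = x"
      using m[OF z x] neg_neg[OF A x] by simp
    show "app2 C p q m x (i \<cdot> x) = zero A"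
      using m[OF x ix[OF x]] neg_neg[OF A x] diff_self[OF x] i[OF x] by simp
    show "app2 C p q m (i \<cdot> x) x = zero A"
      using m[OF ix[OF x] x] diff_self[OF ix[OF x]] i[OF x] by simp
  qed
  moreover have "is_difference C X p q m i d"
    unfolding is_difference_def using m ix neg_neg i by simp
  ultimately show ?thesis
    by blast
qed

section \<open>Arrows between objects with subtractions\<close>

text \<open>The order of the summands is reversed because right cancellation is what is available before
  commutativity.\<close>

lemma arrow_add:
  assumes Y: "subtraction_object C Y P' p' q' d'" and f: "f \<in> hom C X Y"
    and x: "x \<in> hom C A X" and u: "u \<in> hom C A X"
  shows "f \<cdot> add A x u = subtraction_object.add C Y p' q' d' A (f \<cdot> u) (f \<cdot> x)"
proof -
  interpret Y: subtraction_object C Y P' p' q' d'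
    by (rule Y)
  note A = hom_Obj(1)[OF x]
  note z = zero_in_hom[OF A]
  \<comment> \<open>The term condition expects an operation on two elements only, so the stage
    needed by \<open>add\<close> is read off as \<open>Dom C x\<close>.\<close>
  define H where
    "H = (\<lambda>x u. Y.diff (Y.diff (f \<cdot> add (Dom C x) x u) (f \<cdot> x)) (f \<cdot> u))"
  have f_hom: "f \<cdot> v \<in> hom C A Y" if "v \<in> hom C A X" for v A
    using that f by (rule cmp_in_hom)
  have f_zero: "f \<cdot> zero A = Y.zero A"
    using A f by (rule comp_zero_map)
  have "H x u = H x (zero A)"
  proof (rule term_condition[of X X H Y])
    fix A x u assume xu: "x \<in> hom C A X" "u \<in> hom C A X"
    show "H x u \<in> hom C A Y"
      using xu by (simp add: H_def hom_Dom[OF xu(1)] Y.diff_in_hom f_hom add_in_hom)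
    fix B a assume a: "a \<in> hom C B A"
    have fc: "(f \<cdot> v) \<cdot> a = f \<cdot> (v \<cdot> a)" if "v \<in> hom C A X" for v
      using a that f by (rule cmp_assoc)
    show "H x u \<cdot> a = H (x \<cdot> a) (u \<cdot> a)"
      using xu a add_in_hom[OF xu]
      by (simp add: H_def hom_Dom[OF xu(1)] hom_Dom[OF cmp_in_hom[OF a xu(1)]] fc add_comp[of _ A _ _ B]
          Y.diff_comp[of _ A _ _ B] Y.diff_in_hom f_hom)
  next
    \<comment> \<open>Here 0 + v = v by double negation and f(0) = 0, which leaves (f(v) - 0) - f(v)
      = 0.\<close>
    have "H (zero A) v = Y.zero A" if v: "v \<in> hom C A X" for v
      using v by (simp add: H_def hom_Dom[OF z] neg_neg[OF A] f_zero Y.diff_zero Y.diff_self f_hom)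
    then show "H (zero A) u = H (zero A) (zero A)"
      using u z by simp
  qed (use x u z in simp_all)
  also have "H x (zero A) = Y.zero A"
    using x z Y.diff_zero[OF Y.zero_in_hom[OF A]]
    by (simp add: H_def hom_Dom[OF x] diff_self diff_zero f_zero Y.diff_self[OF f_hom[OF x]])
  finally have "Y.diff (Y.diff (f \<cdot> add A x u) (f \<cdot> x)) (f \<cdot> u) = Y.zero A"
    by (simp add: H_def hom_Dom[OF x])
  \<comment> \<open>The vanishing of \<open>H\<close> is undone from the outside in: first the
    difference with f(u) is resolved, then f(x) is added back on the right, which puts f(u) before
    f(x).\<close>
  then have "Y.diff (f \<cdot> add A x u) (f \<cdot> x) = f \<cdot> u"
    by (rule Y.eq_if_diff_zero[OF A Y.diff_in_hom[OF f_hom[OF add_in_hom[OF x u]] f_hom[OF x]]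
          f_hom[OF u]])
  then show ?thesis
    using Y.diff_add_cancel[OF A f_hom[OF add_in_hom[OF x u]] f_hom[OF x]] by simp
qed

text \<open>For the identity arrow, the reversed order of the summands in \<open>arrow_add\<close>
  is exactly commutativity.\<close>

lemma add_commute:
  assumes "x \<in> hom C A X" "u \<in> hom C A X"
  shows "add A x u = add A u x"
  using arrow_add[OF subtraction_object_axioms ide_in_hom[OF X_Obj] assms]
    assms add_in_hom[OF assms] by (simp add: cmp_ide_left)

text \<open>Applying \<open>f\<close> to x = (x - y) + y and commuting the summands in
  \<open>Y\<close> gives f(x) = f(x - y) + f(y). Subtracting f(y) isolates f(x - y).\<close>

lemma arrow_diff:
  assumes Y: "subtraction_object C Y P' p' q' d'" and f: "f \<in> hom C X Y"
    and x: "x \<in> hom C A X" and y: "y \<in> hom C A X"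
  shows "f \<cdot> diff x y = app2 C p' q' d' (f \<cdot> x) (f \<cdot> y)"
proof -
  interpret Y: subtraction_object C Y P' p' q' d'
    by (rule Y)
  note A = hom_Obj(1)[OF x] and D = diff_in_hom[OF x y]
  note h = cmp_in_hom[OF D f] cmp_in_hom[OF y f]
  have "f \<cdot> x = f \<cdot> add A (diff x y) y"
    using diff_add_cancel[OF A x y] by simp
  also have "\<dots> = Y.add A (f \<cdot> diff x y) (f \<cdot> y)"
    using arrow_add[OF Y f D y] Y.add_commute[OF h] by simp
  finally show ?thesis
    using Y.add_diff_cancel[OF A h] by simp
qed

section \<open>Arbitrary group structures with the given difference\<close>

context
  fixes m i
  assumes group: "internal_group C X p q m i" and difference: "is_difference C X p q m i d"
begin

lemma group_hom: "m \<in> hom C P X" "i \<in> hom C X X"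
  using group hom_Dom[OF proj_in_hom(1)] by (auto simp: internal_group_def)

text \<open>The first argument zero is the unit of the group, so d(0,x) is the inverse of x.\<close>

lemma inverse_eq:
  assumes x: "x \<in> hom C A X"
  shows "i \<cdot> x = diff (zero A) x"
proof -
  have "i \<cdot> x \<in> hom C A X"
    using x group_hom(2) by (rule cmp_in_hom)
  then show ?thesis
    using group difference x hom_Obj(1)[OF x] zero_in_hom
    by (simp add: internal_group_def is_difference_def)
qed

text \<open>Since y is the inverse of 0 - y, the difference d(x, 0 - y) is the product of x and y.
  Hence \<open>d\<close> determines the multiplication, and what is known of \<open>add\<close>
  holds for every such \<open>m\<close>.\<close>

lemma mult_eq:
  assumes x: "x \<in> hom C A X" and y: "y \<in> hom C A X"
  shows "app2 C p q m x y = add A x y"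
proof -
  note A = hom_Obj(1)[OF x]
  have n: "diff (zero A) y \<in> hom C A X"
    using zero_in_hom[OF A] y by (rule diff_in_hom)
  show ?thesis
    using difference inverse_eq[OF n] neg_neg[OF A y] A x n by (simp add: is_difference_def)
qed

text \<open>The square of x is x - (0 - x), and a difference vanishes exactly when its two arguments
  coincide.\<close>

lemma opsubtraction_iff:
  "opsubtraction C X p q d \<longleftrightarrow>
     (\<forall>A\<in>Obj C. \<forall>x\<in>hom C A X. app2 C p q m x x = zero_map C A X)"
proof -
  have "diff (zero A) x = x \<longleftrightarrow> app2 C p q m x x = zero A"
    if A: "A \<in> Obj C" and x: "x \<in> hom C A X" for A x
    using mult_eq[OF x x] diff_self[OF x]
      eq_if_diff_zero[OF A x diff_in_hom[OF zero_in_hom[OF A] x]] by auto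
  then show ?thesis
    using d_in_hom hom_Dom[OF proj_in_hom(1)] diff_self by (auto simp: opsubtraction_def)
qed

end

end

theorem proposition2p3:
  fixes E :: "('o, 'a) cat"
  assumes "congruence_hyperextensible E"
  shows
    "(\<forall>X P p q d. is_product E X X P p q \<and> subtraction E X p q d \<longrightarrow>
        (\<exists>m i. internal_group E X p q m i \<and> is_difference E X p q m i d) \<and>
        (\<forall>m i. internal_group E X p q m i \<and> is_difference E X p q m i d \<longrightarrow>
           commutative_op E X p q m)) \<and>
     (\<forall>X P p q d d'. is_product E X X P p q \<and>
        subtraction E X p q d \<and> subtraction E X p q d' \<longrightarrow> d = d') \<and>
     (\<forall>X P p q d Y P' p' q' d' f.
        is_product E X X P p q \<and> subtraction E X p q d \<and>
        is_product E Y Y P' p' q' \<and> subtraction E Y p' q' d' \<and>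
        f \<in> hom E X Y \<longrightarrow> subtraction_hom E X p q d p' q' d' f) \<and>
     (\<forall>X P p q d m i. is_product E X X P p q \<and> subtraction E X p q d \<and>
        internal_group E X p q m i \<and> is_difference E X p q m i d \<longrightarrow>
        (opsubtraction E X p q d \<longleftrightarrow>
           (\<forall>A\<in>Obj E. \<forall>x\<in>hom E A X. app2 E p q m x x = zero_map E A X)))"
proof -
  interpret hyperextensible_category E
    using assms by unfold_locales
  have sub: "subtraction_object E X P p q d"
    if "is_product E X X P p q" "subtraction E X p q d" for X P p q d
    using that by unfold_locales
  show ?thesis
  proof (intro conjI allI impI; (elim conjE)?)
    fix X P p q d
    assume "is_product E X X P p q" "subtraction E X p q d"
    then interpret subtraction_object E X P p q d
      by (rule sub)
    show "\<exists>m i. internal_group E X p q m i \<and> is_difference E X p q m i d"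
      by (rule group_exists)
    fix m i
    assume "internal_group E X p q m i" "is_difference E X p q m i d"
    then show "commutative_op E X p q m"
      using add_commute by (simp add: commutative_op_def mult_eq)
  next
    fix X P p q d d'
    assume P: "is_product E X X P p q" and d: "subtraction E X p q d" and d': "subtraction E X p q d'"
    interpret X: subtraction_object E X P p q d
      using P d by (rule sub)
    interpret X': subtraction_object E X P p q d'
      using P d' by (rule sub)
    \<comment> \<open>The identity is a homomorphism from \<open>d\<close> to \<open>d'\<close>.
      Evaluating this at the universal pair of projections compares the two arrows
      themselves.\<close>
    have "Ide E X \<cdot>\<^bsub>E\<^esub> d = d'"
      using X.arrow_diff[OF sub[OF P d'] ide_in_hom[OF X.X_Obj] X.proj_in_hom]
      by (simp add: X.app2_proj[OF X.d_in_hom] X.app2_proj[OF X'.d_in_hom]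
          cmp_ide_left[OF X.proj_in_hom(1)] cmp_ide_left[OF X.proj_in_hom(2)])
    then show "d = d'"
      using cmp_ide_left[OF X.d_in_hom] by simp
  next
    fix X P p q d Y P' p' q' d' f
    assume X: "is_product E X X P p q" "subtraction E X p q d"
      and Y: "is_product E Y Y P' p' q'" "subtraction E Y p' q' d'" and f: "f \<in> hom E X Y"
    show "subtraction_hom E X p q d p' q' d' f"
      unfolding subtraction_hom_def
      using subtraction_object.arrow_diff[OF sub[OF X] sub[OF Y] f] by blast
  next
    fix X P p q d m i
    assume X: "is_product E X X P p q" "subtraction E X p q d"
      and G: "internal_group E X p q m i" "is_difference E X p q m i d"
    show "opsubtraction E X p q d \<longleftrightarrow>
        (\<forall>A\<in>Obj E. \<forall>x\<in>hom E A X. app2 E p q m x x = zero_map E A X)"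
      by (rule subtraction_object.opsubtraction_iff[OF sub[OF X] G])
  qed
qed

end
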